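(* For every graph $G$ and every integer $r\geq 3$, $$\mathrm{box}(M_r(G))\leq \mathrm{box}(M_3(G))+1,$$ where $M_r(G)$ denotes the generalized Mycielski graph of $G$.
   Context: All graphs are finite, simple and undirected. Boxicity: a box in Euclidean $k$-space is a Cartesian product $I_1\times\cdots\times I_k$ where each $I_j$ is a closed interval on the real line. The boxicity $\mathrm{box}(G)$ is the minimum nonnegative integer $k$ such that $G$ can be represented as the intersection graph of a family of boxes $(B_v)_{v\in V(G)}$ in Euclidean $k$-space, i.e. for distinct vertices $u,v$, $uv\in E(G)$ if and only if $B_u\cap B_v\neq\emptyset$. The boxicity of a complete graph is defined to be $0$. Generalized Mycielski graph: let $r\geq 2$ be an integer, let $V(G)_1,\ldots,V(G)_r$ be disjoint copies of $V(G)$, where $v_i\in V(G)_i$ denotes the copy of $v\in V(G)$, and let $z$ be a new vertex. $M_r(G)$ has vertex set $\{z\}\cup\bigcup_{i=1}^r V(G)_i$ (disjoint union) and edge set $\bigcup_{i=1}^{r+1}E_i$, where $E_1=\{u_1v_1\mid uv\in E(G)\}$, $E_i=\{u_{i-1}v_i,\, v_{i-1}u_i\mid uv\in E(G)\}$ for $i=2,3,\ldots,r$, and $E_{r+1}=\{zu_r\mid u\in V(G)\}$. *)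

theory Defs
  imports Complex_Main "HOL-Library.FuncSet" "Graph_Theory.Pair_Digraph"
begin

text \<open>
  Finite simple undirected graphs are the \<open>pair_graph\<close>s of the Graph Theory library: loopless,
  finite, with a symmetric arc relation, so that an edge \<open>uv\<close> is the pair of arcs
  \<open>(u,v)\<close>, \<open>(v,u)\<close>.
\<close>

section \<open>Boxicity\<close>

text \<open>
  Since the dimension \<open>k\<close> varies, Euclidean \<open>k\<close>-space is \<open>{..<k} \<rightarrow>\<^sub>E UNIV :: (nat \<Rightarrow> real) set\<close>.
  For \<open>k = 0\<close> it is a single point, and this point is the only box. Intervals are nonempty.
\<close>

definition is_box :: "nat \<Rightarrow> (nat \<Rightarrow> real) set \<Rightarrow> bool" where
  "is_box k B \<longleftrightarrow>
     (\<exists>a b. (\<forall>j<k. a j \<le> b j) \<and> B = (\<Pi>\<^sub>E j\<in>{..<k}. {a j..b j}))"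

definition box_representation ::
  "'a pair_pre_digraph \<Rightarrow> nat \<Rightarrow> ('a \<Rightarrow> (nat \<Rightarrow> real) set) \<Rightarrow> bool" where
  "box_representation G k B \<longleftrightarrow>
     (\<forall>v\<in>pverts G. is_box k (B v)) \<and>
     (\<forall>u\<in>pverts G. \<forall>v\<in>pverts G. u \<noteq> v \<longrightarrow> ((u, v) \<in> parcs G \<longleftrightarrow> B u \<inter> B v \<noteq> {}))"

definition boxicity :: "'a pair_pre_digraph \<Rightarrow> nat" where
  "boxicity G = (LEAST k. \<exists>B. box_representation G k B)"

text \<open>
  The minimum is attained for every graph. Use one coordinate per vertex \<open>w\<close>, in which \<open>w\<close> gets
  \<open>[0,0]\<close>, its neighbours \<open>[0,1]\<close> and all other vertices \<open>[1,1]\<close>.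
\<close>

lemma (in pair_graph) ex_box_representation: "\<exists>k B. box_representation G k B"
proof -
  obtain f :: "nat \<Rightarrow> 'a" and k where f: "pverts G = f ` {..<k}"
    using finite_imp_nat_seg_image_inj_on[OF pair_finite_verts] unfolding lessThan_def by blast
  define lo :: "'a \<Rightarrow> nat \<Rightarrow> real"
    where "lo v j = (if v = f j \<or> (f j, v) \<in> parcs G then 0 else 1)" for v j
  define hi :: "'a \<Rightarrow> nat \<Rightarrow> real" where "hi v j = (if v = f j then 0 else 1)" for v j
  define B where "B v = (\<Pi>\<^sub>E j\<in>{..<k}. {lo v j..hi v j})" for v
  have loop: "(x, x) \<notin> parcs G" for x
    using pair_no_loops by fastforce
  have sym: "(y, x) \<in> parcs G" if "(x, y) \<in> parcs G" for x y
    using that pair_sym_arcs by (auto simp: symmetric_def dest: symD)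
  have le: "lo v j \<le> hi v j" for v j
    by (auto simp: lo_def hi_def)
  have "is_box k (B v)" for v
    unfolding is_box_def B_def using le by blast
  moreover have "(u, v) \<in> parcs G \<longleftrightarrow> B u \<inter> B v \<noteq> {}"
    if "u \<in> pverts G" "v \<in> pverts G" "u \<noteq> v" for u v
  proof
    assume uv: "(u, v) \<in> parcs G"
    have le': "lo u j \<le> hi v j \<and> lo v j \<le> hi u j" for j
      using uv sym[OF uv] that(3) by (cases "u = f j"; cases "v = f j") (simp_all add: lo_def hi_def)
    have "(\<lambda>j\<in>{..<k}. max (lo u j) (lo v j)) \<in> B u \<inter> B v"
      unfolding B_def restrict_PiE_iff Int_iff by (simp add: le le')
    then show "B u \<inter> B v \<noteq> {}" by blast
  next
    assume "B u \<inter> B v \<noteq> {}"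
    then obtain x where x: "x \<in> B u" "x \<in> B v" by blast
    from that(1) f obtain j where j: "j < k" "u = f j" by auto
    have "x j \<in> {lo u j..hi u j}" "x j \<in> {lo v j..hi v j}"
      using x j(1) unfolding B_def PiE_iff by blast+
    then show "(u, v) \<in> parcs G"
      using j that(3) by (auto simp: lo_def hi_def split: if_splits)
  qed
  ultimately show ?thesis
    unfolding box_representation_def by blast
qed

text \<open>The convention that complete graphs have boxicity \<open>0\<close> needs no separate clause.\<close>

lemma boxicity_complete:
  assumes "\<And>u v. u \<in> pverts G \<Longrightarrow> v \<in> pverts G \<Longrightarrow> u \<noteq> v \<Longrightarrow> (u, v) \<in> parcs G"
  shows "boxicity G = 0"
proof -
  have "box_representation G 0 (\<lambda>_. {\<lambda>_. undefined})"
    using assms by (auto simp: box_representation_def is_box_def)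
  then show ?thesis
    unfolding boxicity_def by (intro Least_eq_0) blast
qed

section \<open>Generalized Mycielski graphs\<close>

text \<open>\<open>Copy i v\<close> is the copy of \<open>v\<close> in level \<open>i\<close>, and \<open>Apex\<close> is the vertex \<open>z\<close>.\<close>

datatype 'a mycielski_vertex = Apex | Copy nat 'a

text \<open>
  The edges between levels \<open>i - 1\<close> and \<open>i\<close>, and those at \<open>Apex\<close>, contribute both of their arcs.
\<close>

definition mycielski :: "nat \<Rightarrow> 'a pair_pre_digraph \<Rightarrow> 'a mycielski_vertex pair_pre_digraph" where
  "mycielski r G = \<lparr>
     pverts = {Apex} \<union> {Copy i v | i v. i \<in> {1..r} \<and> v \<in> pverts G},
     parcs =
       {(Copy 1 u, Copy 1 v) | u v. (u, v) \<in> parcs G} \<union>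
       (\<Union>i\<in>{2..r}.
          {(Copy (i - 1) u, Copy i v) | u v. (u, v) \<in> parcs G} \<union>
          {(Copy i u, Copy (i - 1) v) | u v. (u, v) \<in> parcs G}) \<union>
       {(Apex, Copy r u) | u. u \<in> pverts G} \<union>
       {(Copy r u, Apex) | u. u \<in> pverts G}\<rparr>"

lemma (in pair_graph) pair_graph_mycielski:
  assumes "r \<ge> 1"
  shows "pair_graph (mycielski r G)"
proof -
  have sym: "(y, x) \<in> parcs G" if "(x, y) \<in> parcs G" for x y
    using that pair_sym_arcs by (auto simp: symmetric_def dest: symD)
  have loop: "(x, x) \<notin> parcs G" for x
    using pair_no_loops by fastforce
  have "pverts (mycielski r G) = insert Apex (case_prod Copy ` ({1..r} \<times> pverts G))"
    by (auto simp: mycielski_def)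
  then have fin: "finite (pverts (mycielski r G))"
    using pair_finite_verts by simp
  have sub: "parcs (mycielski r G) \<subseteq> pverts (mycielski r G) \<times> pverts (mycielski r G)"
    using assms by (auto simp: mycielski_def dest: in_arcsD1 in_arcsD2)
  have mem: "(x, y) \<in> parcs (mycielski r G) \<longleftrightarrow>
      (\<exists>u v. (u, v) \<in> parcs G \<and> x = Copy 1 u \<and> y = Copy 1 v) \<or>
      (\<exists>i\<in>{2..r}. \<exists>u v. (u, v) \<in> parcs G \<and>
         (x = Copy (i - 1) u \<and> y = Copy i v \<or> x = Copy i u \<and> y = Copy (i - 1) v)) \<or>
      (\<exists>u\<in>pverts G. x = Apex \<and> y = Copy r u \<or> x = Copy r u \<and> y = Apex)" for x y
    unfolding mycielski_def pair_pre_digraph.simps by blast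
  have "sym (parcs (mycielski r G))"
    unfolding sym_def mem using sym by blast
  moreover have "fst e \<noteq> snd e" if "e \<in> parcs (mycielski r G)" for e
    using that loop by (auto simp: mycielski_def)
  ultimately show ?thesis
    using fin sub finite_subset[OF sub]
    by unfold_locales (auto simp: symmetric_def)
qed

end

theory Submission
  imports Defs
begin

text \<open>
  In \<open>M\<^sub>r(G)\<close> any two consecutive levels, from the second level on, carry the same bipartite
  graph as levels 2 and 3 of \<open>M\<^sub>3(G)\<close>. Hence the levels \<open>1, 2, 3, 4, 5, \<dots>\<close> of \<open>M\<^sub>r(G)\<close> can be
  folded onto the levels \<open>1, 2, 3, 2, 3, \<dots>\<close> of \<open>M\<^sub>3(G)\<close>, and this preserves both adjacency and
  non-adjacency between copies whose levels differ by at most one (\<open>mycielski_fold_level\<close>).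

  So give each copy in \<open>M\<^sub>r(G)\<close> the box of its folded image in an optimal representation of
  \<open>M\<^sub>3(G)\<close>. What remains is to destroy the intersections between levels that are further apart,
  and a single new coordinate does this: level \<open>i\<close> occupies \<open>[i, i + 1]\<close> there, so that precisely
  the equal and the consecutive levels meet. The apex sits at the point \<open>r + 1\<close> of the new
  coordinate, where it sees level \<open>r\<close> only, and in the old coordinates its box is so large that
  it meets all others.
\<close>

section \<open>Box representations by interval endpoints\<close>

text \<open>
  Two boxes meet iff they meet in every coordinate, so a representation amounts to a choice of
  endpoints satisfying finitely many inequalities.
\<close>

lemma box_Int_nonempty_iff:
  fixes a b c d :: "nat \<Rightarrow> real"
  assumes "\<And>j. j < k \<Longrightarrow> a j \<le> b j" and "\<And>j. j < k \<Longrightarrow> c j \<le> d j"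
  shows "(\<Pi>\<^sub>E j\<in>{..<k}. {a j..b j}) \<inter> (\<Pi>\<^sub>E j\<in>{..<k}. {c j..d j}) \<noteq> {} \<longleftrightarrow>
    (\<forall>j<k. a j \<le> d j \<and> c j \<le> b j)"
proof -
  have "(\<Pi>\<^sub>E j\<in>{..<k}. {a j..b j}) \<inter> (\<Pi>\<^sub>E j\<in>{..<k}. {c j..d j}) =
      (\<Pi>\<^sub>E j\<in>{..<k}. {max (a j) (c j)..min (b j) (d j)})"
    by (simp add: PiE_Int)
  also have "\<dots> \<noteq> {} \<longleftrightarrow> (\<forall>j<k. max (a j) (c j) \<le> min (b j) (d j))"
    by (auto simp: PiE_eq_empty_iff)
  also have "\<dots> \<longleftrightarrow> (\<forall>j<k. a j \<le> d j \<and> c j \<le> b j)"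
    using assms by auto
  finally show ?thesis .
qed

definition interval_representation ::
  "'a pair_pre_digraph \<Rightarrow> nat \<Rightarrow> ('a \<Rightarrow> nat \<Rightarrow> real) \<Rightarrow> ('a \<Rightarrow> nat \<Rightarrow> real) \<Rightarrow> bool" where
  "interval_representation G k a b \<longleftrightarrow>
     (\<forall>v\<in>pverts G. \<forall>j<k. a v j \<le> b v j) \<and>
     (\<forall>u\<in>pverts G. \<forall>v\<in>pverts G. u \<noteq> v \<longrightarrow>
        ((u, v) \<in> parcs G \<longleftrightarrow> (\<forall>j<k. a u j \<le> b v j \<and> a v j \<le> b u j)))"

lemma ex_box_representation_iff:
  "(\<exists>B. box_representation G k B) \<longleftrightarrow> (\<exists>a b. interval_representation G k a b)"
proof
  assume "\<exists>B. box_representation G k B"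
  then obtain B where B: "box_representation G k B" by blast
  then have "\<forall>v\<in>pverts G. \<exists>a b. (\<forall>j<k. a j \<le> b j) \<and> B v = (\<Pi>\<^sub>E j\<in>{..<k}. {a j..b j})"
    by (auto simp: box_representation_def is_box_def)
  then obtain a b where ab: "\<And>v j. v \<in> pverts G \<Longrightarrow> j < k \<Longrightarrow> a v j \<le> b v j"
    "\<And>v. v \<in> pverts G \<Longrightarrow> B v = (\<Pi>\<^sub>E j\<in>{..<k}. {a v j..b v j})"
    by metis
  have "interval_representation G k a b"
    using B ab by (simp add: interval_representation_def box_representation_def box_Int_nonempty_iff)
  then show "\<exists>a b. interval_representation G k a b" by blast
next
  assume "\<exists>a b. interval_representation G k a b"
  then obtain a b where "interval_representation G k a b" by blast
  moreover have "is_box k (\<Pi>\<^sub>E j\<in>{..<k}. {a v j..b v j})" if "\<forall>j<k. a v j \<le> b v j" for v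
    using that unfolding is_box_def by blast
  ultimately have "box_representation G k (\<lambda>v. \<Pi>\<^sub>E j\<in>{..<k}. {a v j..b v j})"
    by (simp add: interval_representation_def box_representation_def box_Int_nonempty_iff)
  then show "\<exists>B. box_representation G k B" by blast
qed

section \<open>Folding the levels of a generalized Mycielski graph\<close>

lemma mycielski_pverts_simps:
  "Apex \<in> pverts (mycielski r G)"
  "Copy i u \<in> pverts (mycielski r G) \<longleftrightarrow> 1 \<le> i \<and> i \<le> r \<and> u \<in> pverts G"
  by (auto simp: mycielski_def)

lemma mycielski_Apex_arc:
  "(Apex, Copy i u) \<in> parcs (mycielski r G) \<longleftrightarrow> i = r \<and> u \<in> pverts G"
  "(Copy i u, Apex) \<in> parcs (mycielski r G) \<longleftrightarrow> i = r \<and> u \<in> pverts G"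
  by (auto simp: mycielski_def)

lemma mycielski_Copy_arc:
  assumes "1 \<le> i" "i \<le> r" "1 \<le> j" "j \<le> r"
  shows "(Copy i u, Copy j v) \<in> parcs (mycielski r G) \<longleftrightarrow>
    (u, v) \<in> parcs G \<and> (i = 1 \<and> j = 1 \<or> j = i + 1 \<or> i = j + 1)"
proof
  assume "(Copy i u, Copy j v) \<in> parcs (mycielski r G)"
  then show "(u, v) \<in> parcs G \<and> (i = 1 \<and> j = 1 \<or> j = i + 1 \<or> i = j + 1)"
    by (auto simp: mycielski_def)
next
  assume uv: "(u, v) \<in> parcs G \<and> (i = 1 \<and> j = 1 \<or> j = i + 1 \<or> i = j + 1)"
  then consider "i = 1 \<and> j = 1" | "j = i + 1" | "i = j + 1" by blast
  then show "(Copy i u, Copy j v) \<in> parcs (mycielski r G)"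
  proof cases
    case 1
    then show ?thesis using uv by (simp add: mycielski_def)
  next
    case 2
    then have "j \<in> {2..r}" "i = j - 1" using assms by auto
    then show ?thesis using uv unfolding mycielski_def pair_pre_digraph.simps by blast
  next
    case 3
    then have "i \<in> {2..r}" "j = i - 1" using assms by auto
    then show ?thesis using uv unfolding mycielski_def pair_pre_digraph.simps by blast
  qed
qed

definition fold_level :: "nat \<Rightarrow> nat" where
  "fold_level i = (if i = 1 then 1 else if even i then 2 else 3)"

lemma fold_level_bounds: "1 \<le> fold_level i" "fold_level i \<le> 3"
  by (auto simp: fold_level_def)

text \<open>
  Closeness of the two levels is essential: levels 1 and 4 fold onto the joined levels 1 and 2, and
  levels 2 and 5 onto 2 and 3. The new coordinate takes care of such pairs.
\<close>

lemma mycielski_fold_level: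
  assumes "1 \<le> i" "i \<le> r" "1 \<le> j" "j \<le> r" "i \<le> j + 1" "j \<le> i + 1"
  shows "(Copy i u, Copy j v) \<in> parcs (mycielski r G) \<longleftrightarrow>
    (Copy (fold_level i) u, Copy (fold_level j) v) \<in> parcs (mycielski 3 G)"
proof -
  have "(i = 1 \<and> j = 1 \<or> j = i + 1 \<or> i = j + 1) \<longleftrightarrow>
      (fold_level i = 1 \<and> fold_level j = 1 \<or>
       fold_level j = fold_level i + 1 \<or> fold_level i = fold_level j + 1)"
  proof -
    consider "j = i" | "j = i + 1" | "i = j + 1" using assms by linarith
    then show ?thesis
      using assms by cases (auto simp: fold_level_def)
  qed
  then show ?thesis
    using assms by (simp only: mycielski_Copy_arc fold_level_bounds)
qed

text \<open>
  Distinct copies on close levels stay distinct after folding, so that their boxes are still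
  governed by adjacency in \<open>M\<^sub>3(G)\<close>.
\<close>

lemma fold_level_eq_imp_eq:
  assumes "fold_level i = fold_level j" "1 \<le> i" "1 \<le> j" "i \<le> j + 1" "j \<le> i + 1"
  shows "i = j"
proof -
  consider "j = i" | "j = i + 1" | "i = j + 1" using assms by linarith
  then show ?thesis
    using assms by cases (auto simp: fold_level_def split: if_splits)
qed

section \<open>One more coordinate suffices\<close>

lemma interval_representation_mycielski:
  assumes fin: "finite (pverts G)" and "1 \<le> r"
    and rep: "interval_representation (mycielski 3 G) k a b"
  shows "\<exists>a b. interval_representation (mycielski r G) (Suc k) a b"
proof -
  let ?V = "{1..3} \<times> pverts G"
  \<comment> \<open>The interval from \<open>- S j\<close> to \<open>S j\<close> contains the left endpoints of all intervals of copies in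
    coordinate \<open>j\<close>, so it meets all these intervals.\<close>
  define S where "S j = (\<Sum>(i, v)\<in>?V. \<bar>a (Copy i v) j\<bar>)" for j
  define a' where "a' x j = (case x of
      Apex \<Rightarrow> if j = k then real r + 1 else - S j
    | Copy i v \<Rightarrow> if j = k then real i else a (Copy (fold_level i) v) j)" for x j
  define b' where "b' x j = (case x of
      Apex \<Rightarrow> if j = k then real r + 1 else S j
    | Copy i v \<Rightarrow> if j = k then real i + 1 else b (Copy (fold_level i) v) j)" for x j
  have S: "\<bar>a (Copy (fold_level i) v) j\<bar> \<le> S j" if "v \<in> pverts G" for i v j
    unfolding S_def
    using member_le_sum[of "(fold_level i, v)" ?V "\<lambda>(i, v). \<bar>a (Copy i v) j\<bar>"]
      that fin fold_level_bounds[of i] by auto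
  have S_nonneg: "0 \<le> S j" for j
    unfolding S_def by (intro sum_nonneg) auto
  have le: "a (Copy (fold_level i) v) j \<le> b (Copy (fold_level i) v) j"
    if "v \<in> pverts G" "j < k" for i v j
    using rep that fold_level_bounds[of i]
    by (auto simp: interval_representation_def mycielski_pverts_simps)
  have meet: "(x, y) \<in> parcs (mycielski r G) \<longleftrightarrow> (\<forall>j<Suc k. a' x j \<le> b' y j \<and> a' y j \<le> b' x j)"
    if xy: "x \<in> pverts (mycielski r G)" "y \<in> pverts (mycielski r G)" "x \<noteq> y" for x y
  proof (cases x)
    case Apex
    with xy obtain i v where y: "y = Copy i v" by (cases y) auto
    have "\<forall>j<k. a' x j \<le> b' y j \<and> a' y j \<le> b' x j"
    proof (intro allI impI)
      fix j assume "j < k"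
      with xy S[of v i j] le[of v j i] show "a' x j \<le> b' y j \<and> a' y j \<le> b' x j"
        by (auto simp: a'_def b'_def y Apex mycielski_pverts_simps)
    qed
    moreover have "a' x k \<le> b' y k \<and> a' y k \<le> b' x k \<longleftrightarrow> i = r"
      using xy by (auto simp: a'_def b'_def y Apex mycielski_pverts_simps)
    ultimately show ?thesis
      using xy by (auto simp: less_Suc_eq y Apex mycielski_Apex_arc mycielski_pverts_simps)
  next
    case x: (Copy i u)
    show ?thesis
    proof (cases y)
      case Apex
      have "\<forall>j<k. a' x j \<le> b' y j \<and> a' y j \<le> b' x j"
      proof (intro allI impI)
        fix j assume "j < k"
        with xy S[of u i j] le[of u j i] show "a' x j \<le> b' y j \<and> a' y j \<le> b' x j"
          by (auto simp: a'_def b'_def x Apex mycielski_pverts_simps)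
      qed
      moreover have "a' x k \<le> b' y k \<and> a' y k \<le> b' x k \<longleftrightarrow> i = r"
        using xy by (auto simp: a'_def b'_def x Apex mycielski_pverts_simps)
      ultimately show ?thesis
        using xy by (auto simp: less_Suc_eq x Apex mycielski_Apex_arc mycielski_pverts_simps)
    next
      case y: (Copy i' v)
      have V: "1 \<le> i" "i \<le> r" "u \<in> pverts G" "1 \<le> i'" "i' \<le> r" "v \<in> pverts G"
        using xy by (auto simp: x y mycielski_pverts_simps)
      have new: "a' x k \<le> b' y k \<and> a' y k \<le> b' x k \<longleftrightarrow> i \<le> i' + 1 \<and> i' \<le> i + 1"
        by (auto simp: a'_def b'_def x y)
      show ?thesis
      proof (cases "i \<le> i' + 1 \<and> i' \<le> i + 1")
        case True
        have "Copy (fold_level i) u \<noteq> Copy (fold_level i') v"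
          using fold_level_eq_imp_eq[of i i'] V True xy(3) by (auto simp: x y)
        then have "(Copy (fold_level i) u, Copy (fold_level i') v) \<in> parcs (mycielski 3 G) \<longleftrightarrow>
            (\<forall>j<k. a' x j \<le> b' y j \<and> a' y j \<le> b' x j)"
          using rep V fold_level_bounds
          by (auto simp: interval_representation_def mycielski_pverts_simps a'_def b'_def x y)
        then show ?thesis
          using mycielski_fold_level[of i r i' u v G] V True new by (auto simp: x y less_Suc_eq)
      next
        case False
        then show ?thesis
          using new mycielski_Copy_arc[of i r i' u v G] V by (auto simp: x y)
      qed
    qed
  qed
  have "a' x j \<le> b' x j" if "x \<in> pverts (mycielski r G)" "j < Suc k" for x j
    using that le S_nonneg[of j]
    by (cases x) (auto simp: a'_def b'_def mycielski_pverts_simps less_Suc_eq)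
  with meet have "interval_representation (mycielski r G) (Suc k) a' b'"
    by (simp add: interval_representation_def)
  then show ?thesis by blast
qed

theorem theorem5p2:
  fixes G :: "'a pair_pre_digraph" and r :: nat
  assumes "pair_graph G" and "r \<ge> 3"
  shows "boxicity (mycielski r G) \<le> boxicity (mycielski 3 G) + 1"
proof -
  interpret pair_graph G by fact
  interpret M3: pair_graph "mycielski 3 G"
    by (rule pair_graph_mycielski) simp
  have "\<exists>B. box_representation (mycielski 3 G) (boxicity (mycielski 3 G)) B"
    unfolding boxicity_def by (rule LeastI_ex) (rule M3.ex_box_representation)
  then obtain a b where "interval_representation (mycielski 3 G) (boxicity (mycielski 3 G)) a b"
    unfolding ex_box_representation_iff by blast
  with assms(2) have "\<exists>B. box_representation (mycielski r G) (Suc (boxicity (mycielski 3 G))) B"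
    unfolding ex_box_representation_iff
    by (intro interval_representation_mycielski) auto
  then show ?thesis
    unfolding boxicity_def[of "mycielski r G"] Suc_eq_plus1 by (rule Least_le)
qed

end
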